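(* Let $\varrho\colon \mathrm{B}_{\mathrm b}\to[0,1]$ be a default risk measure. Then the following conditions are equivalent. \begin{enumerate} \item[(i)] For all $X\in \mathrm{B}_{\mathrm b}$, $\varrho(X)=\varrho\big(\mathbf 1_{\{X>0\}}\big)$. \item[(ii)] $\varrho$ is default scaling invariant and \[ \varrho(X)=\varrho(X^+)=\inf_{\varepsilon>0}\varrho\big(X+\varepsilon\mathbf 1_{\{X>0\}}\big)\quad\text{for all }X\in \mathrm{B}_{\mathrm b}. \] \item[(iii)] $\varrho$ is liquidity invariant and illiquidity invariant. \end{enumerate}
   Context: $(\Omega,\mathcal F)$ is a measurable space ($\Omega\neq\emptyset$) and $\mathrm{B}_{\mathrm b}$ is the space of all bounded measurable functions $\Omega\to\mathbb{R}$, ordered pointwise; real constants are identified with constant functions. $X^+:=X\mathbf 1_{\{X>0\}}$. A map $\varrho\colon \mathrm{B}_{\mathrm b}\to[0,1]$ is a default risk measure if (i) $\varrho(X)\le\varrho(Y)$ whenever $X\le Y$, and (ii) $\varrho(0)=0$ and $\varrho(m)=1$ for all real $m>0$. Such a $\varrho$ is called - default scaling invariant if $\varrho(X)=\varrho(\lambda X)$ for all $\lambda>0$ and all $X\in \mathrm{B}_{\mathrm b}$ with $X\ge0$; - illiquidity invariant if $\varrho(X)=\varrho\big(X+m\mathbf 1_{\{X>0\}}\big)$ for all $m>0$ and all $X\in \mathrm{B}_{\mathrm b}$ with $X\ge 0$; - liquidity invariant if $\varrho(X)=\varrho\big(X-m\mathbf 1_{\{X=0\}}\big)$ for all $m>0$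 and all $X\in \mathrm{B}_{\mathrm b}$ with $X\ge0$. *)

theory Defs
  imports "HOL-Analysis.Analysis"
begin

(* The measurable space is (space M, sets M); the measure carried by M is never used.
   Elements of Bb M are total functions on the underlying type. Their values outside
   space M are junk, which is why the order is taken on space M only. *)

definition Bb :: "'a measure \<Rightarrow> ('a \<Rightarrow> real) set" where
  "Bb M = {X \<in> borel_measurable M. bounded (X ` space M)}"

definition default_risk_measure :: "'a measure \<Rightarrow> (('a \<Rightarrow> real) \<Rightarrow> real) \<Rightarrow> bool" where
  "default_risk_measure M \<rho> \<longleftrightarrow>
     \<rho> \<in> Bb M \<rightarrow> {0..1} \<and>
     (\<forall>X\<in>Bb M. \<forall>Y\<in>Bb M. (\<forall>\<omega>\<in>space M. X \<omega> \<le> Y \<omega>) \<longrightarrow> \<rho> X \<le> \<rho> Y) \<and>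
     \<rho> (\<lambda>_. 0) = 0 \<and> (\<forall>m>0. \<rho> (\<lambda>_. m) = 1)"

(* By monotonicity, a default risk measure does not see the junk values, so it is
   the same thing as a map on bounded measurable functions with domain space M. *)
lemma default_risk_measure_cong:
  assumes "default_risk_measure M \<rho>" "X \<in> Bb M" "Y \<in> Bb M"
    and "\<And>\<omega>. \<omega> \<in> space M \<Longrightarrow> X \<omega> = Y \<omega>"
  shows "\<rho> X = \<rho> Y"
  using assms unfolding default_risk_measure_def by (intro antisym) simp_all

definition default_scaling_invariant :: "'a measure \<Rightarrow> (('a \<Rightarrow> real) \<Rightarrow> real) \<Rightarrow> bool" where
  "default_scaling_invariant M \<rho> \<longleftrightarrow>
     (\<forall>c>0. \<forall>X\<in>Bb M. (\<forall>\<omega>\<in>space M. 0 \<le> X \<omega>) \<longrightarrow> \<rho> X = \<rho> (\<lambda>\<omega>. c * X \<omega>))"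

definition illiquidity_invariant :: "'a measure \<Rightarrow> (('a \<Rightarrow> real) \<Rightarrow> real) \<Rightarrow> bool" where
  "illiquidity_invariant M \<rho> \<longleftrightarrow>
     (\<forall>m>0. \<forall>X\<in>Bb M. (\<forall>\<omega>\<in>space M. 0 \<le> X \<omega>) \<longrightarrow>
        \<rho> X = \<rho> (\<lambda>\<omega>. X \<omega> + m * indicator {\<omega>\<in>space M. 0 < X \<omega>} \<omega>))"

definition liquidity_invariant :: "'a measure \<Rightarrow> (('a \<Rightarrow> real) \<Rightarrow> real) \<Rightarrow> bool" where
  "liquidity_invariant M \<rho> \<longleftrightarrow>
     (\<forall>m>0. \<forall>X\<in>Bb M. (\<forall>\<omega>\<in>space M. 0 \<le> X \<omega>) \<longrightarrow>
        \<rho> X = \<rho> (\<lambda>\<omega>. X \<omega> - m * indicator {\<omega>\<in>space M. X \<omega> = 0} \<omega>))"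

definition pos_part_on :: "'a measure \<Rightarrow> ('a \<Rightarrow> real) \<Rightarrow> 'a \<Rightarrow> real" where
  "pos_part_on M X = (\<lambda>\<omega>. X \<omega> * indicator {\<omega>\<in>space M. 0 < X \<omega>} \<omega>)"

end

theory Submission
  imports Defs
begin

text \<open>
  Condition (i) says that \<open>\<rho> X\<close> depends only on the set \<open>A = {X > 0}\<close>, and every operation in
  (ii) and (iii) leaves this set unchanged. Conversely, let \<open>m\<close> bound \<open>\<bar>X\<bar>\<close>. Under (ii), the
  upper bound follows from \<open>X\<^sup>+ \<le> m 1\<^sub>A\<close> and scaling, and the lower bound from
  \<open>(X + \<epsilon> 1\<^sub>A)\<^sup>+ \<ge> \<epsilon> 1\<^sub>A\<close> and scaling inside the infimum. Under (iii), illiquidity invariance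
  applied to \<open>X\<^sup>+ \<le> 1\<^sub>A + m 1\<^sub>A\<close> and \<open>1\<^sub>A \<le> X\<^sup>+ + 1\<^sub>A\<close> gives \<open>\<rho> (X\<^sup>+) = \<rho> (1\<^sub>A)\<close>, and liquidity
  invariance gives \<open>\<rho> X = \<rho> (X\<^sup>+)\<close> because \<open>X\<^sup>+ - m 1\<^bsub>{X\<^sup>+ = 0}\<^esub> \<le> X \<le> X\<^sup>+\<close>.
\<close>

lemma Bb_obtain_bound:
  assumes "X \<in> Bb M"
  obtains m :: real where "m > 0" "\<And>\<omega>. \<omega> \<in> space M \<Longrightarrow> \<bar>X \<omega>\<bar> \<le> m"
  using assms unfolding Bb_def bounded_pos by auto

lemma Bb_I:
  assumes "X \<in> borel_measurable M" "\<And>\<omega>. \<omega> \<in> space M \<Longrightarrow> \<bar>X \<omega>\<bar> \<le> m"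
  shows "X \<in> Bb M"
  using assms unfolding Bb_def bounded_iff by auto

lemma Bb_measurable [measurable_dest]: "X \<in> Bb M \<Longrightarrow> X \<in> borel_measurable M"
  by (simp add: Bb_def)

lemma Bb_indicator:
  assumes "A \<in> sets M"
  shows "indicator A \<in> Bb M"
  using assms by (intro Bb_I[where m = 1]) (auto simp: indicator_def)

lemma Bb_cmult:
  assumes "X \<in> Bb M"
  shows "(\<lambda>\<omega>. c * X \<omega>) \<in> Bb M"
proof -
  obtain m where m: "\<And>\<omega>. \<omega> \<in> space M \<Longrightarrow> \<bar>X \<omega>\<bar> \<le> m"
    using Bb_obtain_bound[OF assms] by blast
  note [measurable] = Bb_measurable[OF assms]
  show ?thesis
    by (intro Bb_I[where m = "\<bar>c\<bar> * m"]) (auto simp: abs_mult intro: mult_left_mono m)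
qed

lemma Bb_add:
  assumes "X \<in> Bb M" "Y \<in> Bb M"
  shows "(\<lambda>\<omega>. X \<omega> + Y \<omega>) \<in> Bb M"
proof -
  obtain m where m: "\<And>\<omega>. \<omega> \<in> space M \<Longrightarrow> \<bar>X \<omega>\<bar> \<le> m"
    using Bb_obtain_bound[OF assms(1)] by blast
  obtain n where n: "\<And>\<omega>. \<omega> \<in> space M \<Longrightarrow> \<bar>Y \<omega>\<bar> \<le> n"
    using Bb_obtain_bound[OF assms(2)] by blast
  note [measurable] = assms[THEN Bb_measurable]
  show ?thesis
    by (intro Bb_I[where m = "m + n"])
      (auto intro: order_trans[OF abs_triangle_ineq add_mono] m n)
qed

lemma Bb_add_cmult_indicator:
  assumes "X \<in> Bb M" "A \<in> sets M"
  shows "(\<lambda>\<omega>. X \<omega> + c * indicator A \<omega>) \<in> Bb M"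
  by (intro Bb_add Bb_cmult Bb_indicator assms)

lemma Bb_diff_cmult_indicator:
  assumes "X \<in> Bb M" "A \<in> sets M"
  shows "(\<lambda>\<omega>. X \<omega> - c * indicator A \<omega>) \<in> Bb M"
  using Bb_add_cmult_indicator[OF assms, of "- c"] by simp

lemma sets_pos:
  assumes "X \<in> Bb M"
  shows "{\<omega>\<in>space M. 0 < X \<omega>} \<in> sets M"
  using Bb_measurable[OF assms] by measurable

lemma sets_zero:
  assumes "X \<in> Bb M"
  shows "{\<omega>\<in>space M. X \<omega> = 0} \<in> sets M"
  using Bb_measurable[OF assms] by measurable

lemma Bb_pos_part_on:
  assumes "X \<in> Bb M"
  shows "pos_part_on M X \<in> Bb M"
proof -
  obtain m where "m > 0" "\<And>\<omega>. \<omega> \<in> space M \<Longrightarrow> \<bar>X \<omega>\<bar> \<le> m"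
    using Bb_obtain_bound[OF assms] by blast
  moreover note [measurable] = Bb_measurable[OF assms]
  have "pos_part_on M X \<in> borel_measurable M"
    unfolding pos_part_on_def by measurable
  ultimately show ?thesis
    by (intro Bb_I[where m = m]) (auto simp: pos_part_on_def indicator_def intro: abs_le_D1)
qed

text \<open>The form used for pointwise estimates. The restriction to \<open>space M\<close>
  matters: outside it \<open>pos_part_on M X\<close> vanishes, whereas
  \<open>max 0 (X \<omega>)\<close> may be positive.\<close>

lemma pos_part_on_eq_max: "\<omega> \<in> space M \<Longrightarrow> pos_part_on M X \<omega> = max 0 (X \<omega>)"
  by (simp add: pos_part_on_def indicator_def)

lemmas Bb_intros = Bb_indicator Bb_cmult Bb_add_cmult_indicator Bb_diff_cmult_indicator
  Bb_pos_part_on sets_pos sets_zero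

lemma default_risk_measure_mono:
  assumes "default_risk_measure M \<rho>" "X \<in> Bb M" "Y \<in> Bb M"
    and "\<And>\<omega>. \<omega> \<in> space M \<Longrightarrow> X \<omega> \<le> Y \<omega>"
  shows "\<rho> X \<le> \<rho> Y"
  using assms unfolding default_risk_measure_def by blast

lemma default_scaling_invariantD:
  assumes "default_scaling_invariant M \<rho>" "c > 0" "X \<in> Bb M"
    and "\<And>\<omega>. \<omega> \<in> space M \<Longrightarrow> 0 \<le> X \<omega>"
  shows "\<rho> (\<lambda>\<omega>. c * X \<omega>) = \<rho> X"
  using assms unfolding default_scaling_invariant_def by metis

lemma illiquidity_invariantD:
  assumes "illiquidity_invariant M \<rho>" "m > 0" "X \<in> Bb M"
    and "\<And>\<omega>. \<omega> \<in> space M \<Longrightarrow> 0 \<le> X \<omega>"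
  shows "\<rho> (\<lambda>\<omega>. X \<omega> + m * indicator {\<omega>\<in>space M. 0 < X \<omega>} \<omega>) = \<rho> X"
  using assms unfolding illiquidity_invariant_def by metis

lemma liquidity_invariantD:
  assumes "liquidity_invariant M \<rho>" "m > 0" "X \<in> Bb M"
    and "\<And>\<omega>. \<omega> \<in> space M \<Longrightarrow> 0 \<le> X \<omega>"
  shows "\<rho> (\<lambda>\<omega>. X \<omega> - m * indicator {\<omega>\<in>space M. X \<omega> = 0} \<omega>) = \<rho> X"
  using assms unfolding liquidity_invariant_def by metis

text \<open>Under (i), \<open>\<rho>\<close> factors through the positivity set. Each identity in
  (ii) and (iii) thus reduces to checking that a modification of \<open>X\<close> preserves signs in
  this sense.\<close>

lemma eq_if_same_positivity_set:
  assumes "\<forall>X\<in>Bb M. \<rho> X = \<rho> (indicator {\<omega>\<in>space M. 0 < X \<omega>})"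
    and "X \<in> Bb M" "Y \<in> Bb M" "\<And>\<omega>. \<omega> \<in> space M \<Longrightarrow> 0 < X \<omega> \<longleftrightarrow> 0 < Y \<omega>"
  shows "\<rho> X = \<rho> Y"
proof -
  have "{\<omega>\<in>space M. 0 < X \<omega>} = {\<omega>\<in>space M. 0 < Y \<omega>}"
    using assms(4) by blast
  then show ?thesis
    using assms(1-3) by metis
qed

text \<open>\<open>pos\<close> is stated for every \<open>Y\<close> because it is applied both to
  \<open>X\<close> and to its perturbations \<open>X + \<epsilon> 1_A\<close>; the infimum formula
  enters at \<open>X\<close> itself.\<close>

lemma scaling_and_inf_imp_indicator:
  assumes drm: "default_risk_measure M \<rho>" and scal: "default_scaling_invariant M \<rho>"
    and pos: "\<And>Y. Y \<in> Bb M \<Longrightarrow> \<rho> Y = \<rho> (pos_part_on M Y)"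
    and inf: "\<rho> (pos_part_on M X) =
      (INF \<epsilon>\<in>{0<..}. \<rho> (\<lambda>\<omega>. X \<omega> + \<epsilon> * indicator {\<omega>\<in>space M. 0 < X \<omega>} \<omega>))"
    and X: "X \<in> Bb M"
  shows "\<rho> X = \<rho> (indicator {\<omega>\<in>space M. 0 < X \<omega>})"
proof (rule antisym)
  define A where "A = {\<omega>\<in>space M. 0 < X \<omega>}"
  have A: "A \<in> sets M"
    unfolding A_def by (rule sets_pos[OF X])
  have scal_A: "\<rho> (\<lambda>\<omega>. c * indicator A \<omega>) = \<rho> (indicator A)" if "c > 0" for c
    using that by (intro default_scaling_invariantD[OF scal] Bb_indicator A) auto
  obtain m where m: "m > 0" "\<And>\<omega>. \<omega> \<in> space M \<Longrightarrow> \<bar>X \<omega>\<bar> \<le> m"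
    using Bb_obtain_bound[OF X] by blast
  have "\<rho> (pos_part_on M X) \<le> \<rho> (\<lambda>\<omega>. m * indicator A \<omega>)"
    by (intro default_risk_measure_mono[OF drm] Bb_intros X A)
      (use m in \<open>force simp: pos_part_on_def A_def indicator_def\<close>)
  then show "\<rho> X \<le> \<rho> (indicator {\<omega>\<in>space M. 0 < X \<omega>})"
    using pos[OF X] scal_A[OF m(1)] by (simp add: A_def)
  have "\<rho> (indicator A) \<le> \<rho> (\<lambda>\<omega>. X \<omega> + \<epsilon> * indicator A \<omega>)" if "\<epsilon> > 0" for \<epsilon>
  proof -
    have "\<rho> (indicator A) = \<rho> (\<lambda>\<omega>. \<epsilon> * indicator A \<omega>)"
      using scal_A[OF that] by simp
    \<comment> \<open>Off \<open>A\<close> the perturbed function may be negative, so only its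
      positive part dominates \<open>\<epsilon> 1_A\<close> everywhere.\<close>
    also have "\<dots> \<le> \<rho> (pos_part_on M (\<lambda>\<omega>. X \<omega> + \<epsilon> * indicator A \<omega>))"
      by (intro default_risk_measure_mono[OF drm] Bb_intros X A)
        (auto simp: pos_part_on_eq_max A_def indicator_def)
    also have "\<dots> = \<rho> (\<lambda>\<omega>. X \<omega> + \<epsilon> * indicator A \<omega>)"
      by (intro pos[symmetric] Bb_intros X A)
    finally show ?thesis .
  qed
  then have "\<rho> (indicator A) \<le> (INF \<epsilon>\<in>{0<..}. \<rho> (\<lambda>\<omega>. X \<omega> + \<epsilon> * indicator A \<omega>))"
    by (intro cINF_greatest) auto
  then show "\<rho> (indicator {\<omega>\<in>space M. 0 < X \<omega>}) \<le> \<rho> X"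
    using pos[OF X] inf by (simp add: A_def)
qed

text \<open>Illiquidity invariance adds constants on the positivity set instead of scaling, so the
  upper bound \<open>m 1_A\<close> for the positive part is enlarged to
  \<open>1_A + m 1_A\<close>.\<close>

lemma liquidity_and_illiquidity_imp_indicator:
  assumes drm: "default_risk_measure M \<rho>"
    and liq: "liquidity_invariant M \<rho>" and illiq: "illiquidity_invariant M \<rho>"
    and X: "X \<in> Bb M"
  shows "\<rho> X = \<rho> (indicator {\<omega>\<in>space M. 0 < X \<omega>})"
proof -
  define A where "A = {\<omega>\<in>space M. 0 < X \<omega>}"
  have A: "A \<in> sets M"
    unfolding A_def by (rule sets_pos[OF X])
  obtain m where m: "m > 0" "\<And>\<omega>. \<omega> \<in> space M \<Longrightarrow> \<bar>X \<omega>\<bar> \<le> m"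
    using Bb_obtain_bound[OF X] by blast
  let ?P = "pos_part_on M X"
  have P: "?P \<in> Bb M"
    by (rule Bb_pos_part_on[OF X])
  \<comment> \<open>Both \<open>?P\<close> and \<open>1_A\<close> have positivity set
    \<open>A\<close>, so illiquidity invariance adds multiples of the same indicator to
    either.\<close>
  have pos_P: "{\<omega>\<in>space M. 0 < ?P \<omega>} = A"
    by (auto simp: A_def pos_part_on_eq_max)
  have pos_A: "{\<omega>\<in>space M. 0 < (indicator A \<omega> :: real)} = A"
    by (auto simp: A_def indicator_def)
  have "\<rho> ?P = \<rho> (\<lambda>\<omega>. ?P \<omega> - m * indicator {\<omega>\<in>space M. ?P \<omega> = 0} \<omega>)"
    by (rule liquidity_invariantD[OF liq m(1) P, symmetric]) (simp add: pos_part_on_eq_max)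
  \<comment> \<open>On \<open>A\<close> nothing is subtracted and \<open>?P = X\<close>; off
    \<open>A\<close> the left side is \<open>-m\<close>, a lower bound of \<open>X\<close>.\<close>
  also have "\<dots> \<le> \<rho> X"
  proof (intro default_risk_measure_mono[OF drm] Bb_intros P X)
    fix \<omega> assume "\<omega> \<in> space M"
    then show "?P \<omega> - m * indicator {\<omega>\<in>space M. ?P \<omega> = 0} \<omega> \<le> X \<omega>"
      using m(2)[of \<omega>] by (auto simp: pos_part_on_eq_max indicator_def max_def)
  qed
  finally have "\<rho> ?P \<le> \<rho> X" .
  moreover have "\<rho> X \<le> \<rho> ?P"
    by (intro default_risk_measure_mono[OF drm] P X) (simp add: pos_part_on_eq_max)
  moreover have "\<rho> ?P \<le> \<rho> (indicator A)"
  proof -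
    have "\<rho> ?P \<le> \<rho> (\<lambda>\<omega>. indicator A \<omega> + m * indicator A \<omega>)"
      by (intro default_risk_measure_mono[OF drm] Bb_intros P A)
        (use m in \<open>force simp: pos_part_on_def A_def indicator_def\<close>)
    also have "\<dots> = \<rho> (indicator A)"
      using illiquidity_invariantD[OF illiq m(1) Bb_indicator[OF A]] by (simp add: pos_A)
    finally show ?thesis .
  qed
  moreover have "\<rho> (indicator A) \<le> \<rho> ?P"
  proof -
    \<comment> \<open>Holds since \<open>?P\<close> is nonnegative. The explicit factor
      \<open>1\<close> matches the shape of \<open>Bb_add_cmult_indicator\<close>.\<close>
    have "\<rho> (indicator A) \<le> \<rho> (\<lambda>\<omega>. ?P \<omega> + 1 * indicator A \<omega>)"
      by (intro default_risk_measure_mono[OF drm] Bb_intros P A)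
        (simp add: pos_part_on_eq_max)
    also have "\<dots> = \<rho> ?P"
      using illiquidity_invariantD[OF illiq zero_less_one P]
      by (simp add: pos_P pos_part_on_eq_max)
    finally show ?thesis .
  qed
  ultimately show ?thesis
    by (simp add: A_def)
qed

theorem theorem31:
  fixes M :: "'a measure" and \<rho> :: "('a \<Rightarrow> real) \<Rightarrow> real"
  assumes "space M \<noteq> {}"
    and "default_risk_measure M \<rho>"
  defines "cond_i \<equiv> \<forall>X\<in>Bb M. \<rho> X = \<rho> (indicator {\<omega>\<in>space M. 0 < X \<omega>})"
    and "cond_ii \<equiv> default_scaling_invariant M \<rho> \<and>
      (\<forall>X\<in>Bb M. \<rho> X = \<rho> (pos_part_on M X) \<and>
        \<rho> (pos_part_on M X) =
          (INF \<epsilon>\<in>{0<..}. \<rho> (\<lambda>\<omega>. X \<omega> + \<epsilon> * indicator {\<omega>\<in>space M. 0 < X \<omega>} \<omega>)))"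
    and "cond_iii \<equiv> liquidity_invariant M \<rho> \<and> illiquidity_invariant M \<rho>"
  shows "(cond_i \<longleftrightarrow> cond_ii) \<and> (cond_ii \<longleftrightarrow> cond_iii)"
proof -
  have "cond_ii" if "cond_i"
    unfolding cond_ii_def default_scaling_invariant_def
  proof (intro conjI allI ballI impI)
    note eqI = eq_if_same_positivity_set[OF that[unfolded cond_i_def]]
    fix X assume X: "X \<in> Bb M"
    show "\<rho> X = \<rho> (\<lambda>\<omega>. c * X \<omega>)" if "c > 0" for c
      using that by (intro eqI Bb_intros X) (simp add: zero_less_mult_iff)
    show P: "\<rho> X = \<rho> (pos_part_on M X)"
      by (intro eqI Bb_intros X) (auto simp: pos_part_on_eq_max)
    \<comment> \<open>The family is constant in \<open>\<epsilon>\<close>, so its infimum over the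
      nonempty set \<open>{0<..}\<close> is that constant.\<close>
    have "\<rho> (\<lambda>\<omega>. X \<omega> + \<epsilon> * indicator {\<omega>\<in>space M. 0 < X \<omega>} \<omega>) = \<rho> X" if "\<epsilon> > 0" for \<epsilon>
      using that by (intro eqI Bb_intros X) (auto simp: indicator_def)
    then show "\<rho> (pos_part_on M X) =
        (INF \<epsilon>\<in>{0<..}. \<rho> (\<lambda>\<omega>. X \<omega> + \<epsilon> * indicator {\<omega>\<in>space M. 0 < X \<omega>} \<omega>))"
      by (simp add: P)
  qed
  moreover have "cond_iii" if "cond_i"
    unfolding cond_iii_def liquidity_invariant_def illiquidity_invariant_def
  proof (intro conjI allI ballI impI)
    note eqI = eq_if_same_positivity_set[OF that[unfolded cond_i_def]]
    fix X and m :: real assume X: "X \<in> Bb M" and m: "m > 0"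
    \<comment> \<open>Where \<open>X\<close> is zero the new value is \<open>-m\<close>, and neither
      is positive.\<close>
    show "\<rho> X = \<rho> (\<lambda>\<omega>. X \<omega> - m * indicator {\<omega>\<in>space M. X \<omega> = 0} \<omega>)"
      using m by (intro eqI Bb_intros X) (auto simp: indicator_def)
    show "\<rho> X = \<rho> (\<lambda>\<omega>. X \<omega> + m * indicator {\<omega>\<in>space M. 0 < X \<omega>} \<omega>)"
      using m by (intro eqI Bb_intros X) (auto simp: indicator_def)
  qed
  moreover have "cond_i" if "cond_ii"
    using scaling_and_inf_imp_indicator[OF assms(2)] that
    unfolding cond_i_def cond_ii_def by blast
  moreover have "cond_i" if "cond_iii"
    using liquidity_and_illiquidity_imp_indicator[OF assms(2)] that
    unfolding cond_i_def cond_iii_def by blast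
  ultimately show ?thesis
    by blast
qed

end
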